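(* Let $\lambda$ be a dominant analytically integral weight of $G$ and let $1\le p\le\infty$. If $f\in L^p(G/L)$, then $B^\lambda f=d_\lambda\, f*|\Delta^\lambda|^2$. As an operator $B^\lambda:L^p(G/L)\to L^p(G/L)$, one has $\|B^\lambda\|_{\mathrm{op}}\le1$.
   Context: $G$ is a compact connected Lie group with normalized Haar measure $dy$, with a fixed maximal torus and a fixed positive root system. $(\sigma^\lambda,\mathcal H_\lambda)$ is the irreducible unitary representation of $G$ with highest weight $\lambda$ (inner products linear in the first variable), $d_\lambda=\dim\mathcal H_\lambda$, $v_\lambda$ a unit highest-weight vector, $\Delta^\lambda(g)=\langle v_\lambda,\sigma^\lambda(g)v_\lambda\rangle$, and $L=\{g\in G:\sigma^\lambda(g)v_\lambda\in\mathbb C v_\lambda\}$. Functions on $G/L$ are identified with right-$L$-invariant functions on $G$, and $G/L$ carries the $G$-invariant probability measure. Convolution: $(f*g)(x)=\int_G f(y)g(y^{-1}x)\,dy$. For $f\in L^1(G/L)$ the Toeplitz operator $T^\lambda_f\in\mathrm{End}(\mathcal H_\lambda)$ is given by $$\langle T^\lambda_f v,w\rangle=d_\lambda\int_G f(y)\langle v,\sigma^\lambda(y)v_\lambda\rangle\overline{\langle w,\sigma^\lambda(y)v_\lambda\rangle}\,dy ,$$ and the Berezin transform of $f$ is the function on $G/L$ given by $B^\lambda f(xL)=\langle T^\lambda_f\sigma^\lambda(x)v_\lambda,\sigma^\lambda(x)v_\lambda\rangle$. *)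

theory Defs
  imports "HOL-Probability.Probability" "HOL-Algebra.Group"
begin

section \<open>Finite-dimensional complex Hilbert spaces\<close>

text \<open>The types of this class are the nonzero finite-dimensional complex Hilbert spaces, with inner
  product linear in the first variable. The inherited Euclidean structure is the underlying real
  one, so the topology and real derivatives come from the library.\<close>

class complex_euclidean_space = euclidean_space +
  fixes scaleC :: "complex \<Rightarrow> 'a \<Rightarrow> 'a" (infixr \<open>*\<^sub>C\<close> 75)
    and cinner :: "'a \<Rightarrow> 'a \<Rightarrow> complex"
  assumes scaleC_add_right: "a *\<^sub>C (x + y) = a *\<^sub>C x + a *\<^sub>C y"
    and scaleC_add_left: "(a + b) *\<^sub>C x = a *\<^sub>C x + b *\<^sub>C x"
    and scaleC_scaleC: "a *\<^sub>C (b *\<^sub>C x) = (a * b) *\<^sub>C x"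
    and scaleC_of_real: "complex_of_real r *\<^sub>C x = r *\<^sub>R x"
    and cinner_add_left: "cinner (x + y) z = cinner x z + cinner y z"
    and cinner_scaleC_left: "cinner (a *\<^sub>C x) y = a * cinner x y"
    and cinner_commute: "cinner x y = cnj (cinner y x)"
    and Re_cinner: "Re (cinner x y) = inner x y"

global_interpretation complex_vector: vector_space "scaleC :: complex \<Rightarrow> 'a \<Rightarrow> 'a::complex_euclidean_space"
  by unfold_locales
    (simp_all add: scaleC_add_right scaleC_add_left scaleC_scaleC
       scaleC_of_real[of 1, simplified])

instantiation complex :: complex_euclidean_space
begin

definition scaleC_complex :: "complex \<Rightarrow> complex \<Rightarrow> complex"
  where "scaleC_complex a x = a * x"

definition cinner_complex :: "complex \<Rightarrow> complex \<Rightarrow> complex"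
  where "cinner_complex x y = x * cnj y"

instance
  by standard
    (simp_all add: scaleC_complex_def cinner_complex_def algebra_simps scaleR_conv_of_real
      inner_complex_def)

end

instantiation vec :: (complex_euclidean_space, finite) complex_euclidean_space
begin

definition scaleC_vec :: "complex \<Rightarrow> 'a ^ 'b \<Rightarrow> 'a ^ 'b"
  where "scaleC_vec a x = (\<chi> i. a *\<^sub>C (x $ i))"

definition cinner_vec :: "'a ^ 'b \<Rightarrow> 'a ^ 'b \<Rightarrow> complex"
  where "cinner_vec x y = (\<Sum>i\<in>UNIV. cinner (x $ i) (y $ i))"

instance
proof
  fix x y :: "'a ^ 'b"
  show "cinner x y = cnj (cinner y x)"
    by (simp add: cinner_vec_def cnj_sum cinner_commute[symmetric])
qed (simp_all add: scaleC_vec_def cinner_vec_def vec_eq_iff scaleC_add_right scaleC_add_left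
      scaleC_scaleC scaleC_of_real cinner_add_left cinner_scaleC_left sum.distrib
      sum_distrib_left Re_cinner inner_vec_def)

end

definition cdim :: "'h::complex_euclidean_space itself \<Rightarrow> nat" where
  "cdim _ = complex_vector.dim (UNIV :: 'h set)"


section \<open>Compact connected Lie groups\<close>

primrec Ck_on :: "nat \<Rightarrow> 'a::euclidean_space set \<Rightarrow> ('a \<Rightarrow> 'b::euclidean_space) \<Rightarrow> bool" where
  "Ck_on 0 S f \<longleftrightarrow> continuous_on S f"
| "Ck_on (Suc k) S f \<longleftrightarrow>
     (\<forall>x\<in>S. f differentiable (at x)) \<and> (\<forall>v. Ck_on k S (\<lambda>x. frechet_derivative f (at x) v))"

text \<open>Smoothness on an arbitrary set means local extendability to smooth functions on open sets.
  For relatively open subsets of a linear subspace this is smoothness in the usual sense.\<close>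

definition smooth_on :: "'a::euclidean_space set \<Rightarrow> ('a \<Rightarrow> 'b::euclidean_space) \<Rightarrow> bool" where
  "smooth_on S f \<longleftrightarrow>
     (\<forall>x\<in>S. \<exists>W F. open W \<and> x \<in> W \<and> (\<forall>k. Ck_on k W F) \<and> (\<forall>y\<in>S \<inter> W. F y = f y))"

text \<open>The manifold is modelled on a linear subspace of a Euclidean space rather than on the whole
  space, because every type of class \<open>euclidean_space\<close> has positive dimension and the
  zero-dimensional group must not be excluded. The topology of the group is that of the element
  type, which is therefore required to be the whole carrier.\<close>

record ('g, 'e) lie_group = "'g monoid" +
  model :: "'e set"
  charts :: "('g set \<times> ('g \<Rightarrow> 'e)) set"

definition smooth_atlas ::
    "('g::topological_space, 'e::euclidean_space) lie_group \<Rightarrow> bool" where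
  "smooth_atlas G \<longleftrightarrow>
     subspace (model G) \<and>
     (\<Union>(U, \<phi>)\<in>charts G. U) = UNIV \<and>
     (\<forall>(U, \<phi>)\<in>charts G. open U \<and> openin (top_of_set (model G)) (\<phi> ` U) \<and>
        homeomorphism U (\<phi> ` U) \<phi> (inv_into U \<phi>)) \<and>
     (\<forall>(U, \<phi>)\<in>charts G. \<forall>(V, \<psi>)\<in>charts G. smooth_on (\<phi> ` (U \<inter> V)) (\<psi> \<circ> inv_into U \<phi>))"

definition Lie_group ::
    "('g::{t2_space, second_countable_topology}, 'e::euclidean_space) lie_group \<Rightarrow> bool" where
  "Lie_group G \<longleftrightarrow>
     group G \<and> carrier G = UNIV \<and>
     continuous_on UNIV (\<lambda>(x, y). x \<otimes>\<^bsub>G\<^esub> y) \<and> continuous_on UNIV (\<lambda>x. inv\<^bsub>G\<^esub> x) \<and>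
     smooth_atlas G \<and>
     (\<forall>(U, \<phi>)\<in>charts G. \<forall>(V, \<psi>)\<in>charts G. \<forall>(W, \<theta>)\<in>charts G.
        smooth_on {(a, b). a \<in> \<phi> ` U \<and> b \<in> \<psi> ` V \<and> inv_into U \<phi> a \<otimes>\<^bsub>G\<^esub> inv_into V \<psi> b \<in> W}
          (\<lambda>(a, b). \<theta> (inv_into U \<phi> a \<otimes>\<^bsub>G\<^esub> inv_into V \<psi> b))) \<and>
     (\<forall>(U, \<phi>)\<in>charts G. \<forall>(V, \<psi>)\<in>charts G.
        smooth_on {a \<in> \<phi> ` U. inv\<^bsub>G\<^esub> (inv_into U \<phi> a) \<in> V} (\<lambda>a. \<psi> (inv\<^bsub>G\<^esub> (inv_into U \<phi> a))))"

definition compact_connected_Lie_group ::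
    "('g::{t2_space, second_countable_topology}, 'e::euclidean_space) lie_group \<Rightarrow> bool" where
  "compact_connected_Lie_group G \<longleftrightarrow>
     Lie_group G \<and> compact (UNIV :: 'g set) \<and> connected (UNIV :: 'g set)"


section \<open>Lie algebra, maximal tori, roots\<close>

text \<open>The Lie algebra is the tangent space at the identity, identified with \<open>model G\<close> through the
  differential of a chart around the identity. The choice of chart is immaterial: another choice
  only changes everything below by a linear isomorphism.\<close>

definition id_chart :: "('g::topological_space, 'e::euclidean_space) lie_group \<Rightarrow> 'g \<Rightarrow> 'e" where
  "id_chart G = snd (SOME c. c \<in> charts G \<and> \<one>\<^bsub>G\<^esub> \<in> fst c)"

definition one_parameter_subgroup ::
    "('g::topological_space, 'e::euclidean_space) lie_group \<Rightarrow> 'e \<Rightarrow> (real \<Rightarrow> 'g) \<Rightarrow> bool" where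
  "one_parameter_subgroup G X \<gamma> \<longleftrightarrow>
     continuous_on UNIV \<gamma> \<and> (\<forall>s t. \<gamma> (s + t) = \<gamma> s \<otimes>\<^bsub>G\<^esub> \<gamma> t) \<and>
     ((\<lambda>t. id_chart G (\<gamma> t)) has_vector_derivative X) (at 0)"

definition lie_exp :: "('g::topological_space, 'e::euclidean_space) lie_group \<Rightarrow> 'e \<Rightarrow> 'g" where
  "lie_exp G X = (THE \<gamma>. one_parameter_subgroup G X \<gamma>) 1"

definition Ad :: "('g::topological_space, 'e::euclidean_space) lie_group \<Rightarrow> 'g \<Rightarrow> 'e \<Rightarrow> 'e" where
  "Ad G g X =
     vector_derivative (\<lambda>t. id_chart G (g \<otimes>\<^bsub>G\<^esub> lie_exp G (t *\<^sub>R X) \<otimes>\<^bsub>G\<^esub> inv\<^bsub>G\<^esub> g)) (at 0)"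

definition lie_bracket ::
    "('g::topological_space, 'e::euclidean_space) lie_group \<Rightarrow> 'e \<Rightarrow> 'e \<Rightarrow> 'e" where
  "lie_bracket G X Y = vector_derivative (\<lambda>t. Ad G (lie_exp G (t *\<^sub>R X)) Y) (at 0)"

definition torus_subgroup ::
    "('g::topological_space, 'e::euclidean_space) lie_group \<Rightarrow> 'g set \<Rightarrow> bool" where
  "torus_subgroup G T \<longleftrightarrow>
     subgroup T G \<and> compact T \<and> connected T \<and> (\<forall>x\<in>T. \<forall>y\<in>T. x \<otimes>\<^bsub>G\<^esub> y = y \<otimes>\<^bsub>G\<^esub> x)"

definition maximal_torus ::
    "('g::topological_space, 'e::euclidean_space) lie_group \<Rightarrow> 'g set \<Rightarrow> bool" where
  "maximal_torus G T \<longleftrightarrow>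
     torus_subgroup G T \<and> (\<forall>T'. torus_subgroup G T' \<and> T \<subseteq> T' \<longrightarrow> T' = T)"

definition torus_algebra ::
    "('g::topological_space, 'e::euclidean_space) lie_group \<Rightarrow> 'g set \<Rightarrow> 'e set" where
  "torus_algebra G T = {H \<in> model G. \<forall>s. lie_exp G (s *\<^sub>R H) \<in> T}"

text \<open>With \<open>t\<close> the Lie algebra of the torus, a complex linear functional on the
  complexification of \<open>t\<close> is the same as a real linear map from \<open>t\<close> to the complex numbers.
  Functionals are extended by zero outside \<open>t\<close>, so that equal functionals are equal functions.\<close>

definition torus_functional ::
    "('g::topological_space, 'e::euclidean_space) lie_group \<Rightarrow> 'g set \<Rightarrow> ('e \<Rightarrow> complex) \<Rightarrow> bool" where
  "torus_functional G T \<nu> \<longleftrightarrow>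
     (\<forall>H\<in>torus_algebra G T. \<forall>K\<in>torus_algebra G T. \<nu> (H + K) = \<nu> H + \<nu> K) \<and>
     (\<forall>c. \<forall>H\<in>torus_algebra G T. \<nu> (c *\<^sub>R H) = c *\<^sub>R \<nu> H) \<and>
     (\<forall>H. H \<notin> torus_algebra G T \<longrightarrow> \<nu> H = 0)"

definition analytically_integral ::
    "('g::topological_space, 'e::euclidean_space) lie_group \<Rightarrow> 'g set \<Rightarrow> ('e \<Rightarrow> complex) \<Rightarrow> bool" where
  "analytically_integral G T \<nu> \<longleftrightarrow>
     torus_functional G T \<nu> \<and>
     (\<forall>H\<in>torus_algebra G T. lie_exp G H = \<one>\<^bsub>G\<^esub> \<longrightarrow> (\<exists>k::int. \<nu> H = 2 * pi * \<i> * of_int k))"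

text \<open>A pair \<open>(X, Y)\<close> stands for the element \<open>X + \<i>Y\<close> of the complexified Lie algebra; the two
  equations are the real and imaginary parts of \<open>[H, X + \<i>Y] = \<alpha>(H) (X + \<i>Y)\<close>.\<close>

definition root_space ::
    "('g::topological_space, 'e::euclidean_space) lie_group \<Rightarrow> 'g set \<Rightarrow> ('e \<Rightarrow> complex) \<Rightarrow> ('e \<times> 'e) set"
  where
  "root_space G T \<alpha> = {(X, Y). X \<in> model G \<and> Y \<in> model G \<and>
     (\<forall>H\<in>torus_algebra G T.
        lie_bracket G H X = Re (\<alpha> H) *\<^sub>R X - Im (\<alpha> H) *\<^sub>R Y \<and>
        lie_bracket G H Y = Im (\<alpha> H) *\<^sub>R X + Re (\<alpha> H) *\<^sub>R Y)}"

definition roots ::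
    "('g::topological_space, 'e::euclidean_space) lie_group \<Rightarrow> 'g set \<Rightarrow> ('e \<Rightarrow> complex) set" where
  "roots G T = {\<alpha>. torus_functional G T \<alpha> \<and> \<alpha> \<noteq> (\<lambda>_. 0) \<and> root_space G T \<alpha> \<noteq> {(0, 0)}}"

definition positive_system ::
    "('g::topological_space, 'e::euclidean_space) lie_group \<Rightarrow> 'g set \<Rightarrow> ('e \<Rightarrow> complex) set \<Rightarrow> bool"
  where
  "positive_system G T P \<longleftrightarrow>
     P \<subseteq> roots G T \<and>
     (\<forall>\<alpha>\<in>roots G T. (\<alpha> \<in> P) \<noteq> ((\<lambda>H. - \<alpha> H) \<in> P)) \<and>
     (\<forall>\<alpha>\<in>P. \<forall>\<beta>\<in>P. (\<lambda>H. \<alpha> H + \<beta> H) \<in> roots G T \<longrightarrow> (\<lambda>H. \<alpha> H + \<beta> H) \<in> P)"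

definition Ad_invariant_inner ::
    "('g::topological_space, 'e::euclidean_space) lie_group \<Rightarrow> ('e \<Rightarrow> 'e \<Rightarrow> real) \<Rightarrow> bool" where
  "Ad_invariant_inner G B \<longleftrightarrow>
     (\<forall>X\<in>model G. \<forall>Y\<in>model G. \<forall>Z\<in>model G. \<forall>c.
        B (X + Y) Z = B X Z + B Y Z \<and> B (c *\<^sub>R X) Y = c * B X Y \<and> B X Y = B Y X) \<and>
     (\<forall>X\<in>model G. X \<noteq> 0 \<longrightarrow> 0 < B X X) \<and>
     (\<forall>g. \<forall>X\<in>model G. \<forall>Y\<in>model G. B (Ad G g X) (Ad G g Y) = B X Y)"

text \<open>Roots and analytically integral functionals take imaginary values on \<open>t\<close>, so they are
  represented with respect to \<open>B\<close> by their imaginary parts.\<close>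

definition dual_vector ::
    "('g::topological_space, 'e::euclidean_space) lie_group \<Rightarrow> 'g set \<Rightarrow> ('e \<Rightarrow> 'e \<Rightarrow> real) \<Rightarrow>
      ('e \<Rightarrow> complex) \<Rightarrow> 'e" where
  "dual_vector G T B \<nu> =
     (THE H. H \<in> torus_algebra G T \<and> (\<forall>K\<in>torus_algebra G T. B H K = Im (\<nu> K)))"

text \<open>The signs of the inner products below do not depend on the choice of the invariant inner
  product \<open>B\<close>, one of which exists by compactness.\<close>

definition dominant ::
    "('g::topological_space, 'e::euclidean_space) lie_group \<Rightarrow> 'g set \<Rightarrow> ('e \<Rightarrow> complex) set \<Rightarrow>
      ('e \<Rightarrow> complex) \<Rightarrow> bool" where
  "dominant G T P \<nu> \<longleftrightarrow>
     (\<exists>B. Ad_invariant_inner G B \<and>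
        (\<forall>\<alpha>\<in>P. 0 \<le> B (dual_vector G T B \<nu>) (dual_vector G T B \<alpha>)))"


section \<open>Irreducible unitary representations\<close>

definition unitary_representation ::
    "('g::topological_space, 'e::euclidean_space) lie_group \<Rightarrow>
      ('g \<Rightarrow> 'h \<Rightarrow> 'h::complex_euclidean_space) \<Rightarrow> bool" where
  "unitary_representation G \<sigma> \<longleftrightarrow>
     (\<forall>g. Vector_Spaces.linear scaleC scaleC (\<sigma> g)) \<and>
     \<sigma> \<one>\<^bsub>G\<^esub> = id \<and> (\<forall>g h. \<sigma> (g \<otimes>\<^bsub>G\<^esub> h) = \<sigma> g \<circ> \<sigma> h) \<and>
     (\<forall>g u w. cinner (\<sigma> g u) (\<sigma> g w) = cinner u w) \<and>
     (\<forall>u. continuous_on UNIV (\<lambda>g. \<sigma> g u))"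

definition irreducible_unitary_representation ::
    "('g::topological_space, 'e::euclidean_space) lie_group \<Rightarrow>
      ('g \<Rightarrow> 'h \<Rightarrow> 'h::complex_euclidean_space) \<Rightarrow> bool" where
  "irreducible_unitary_representation G \<sigma> \<longleftrightarrow>
     unitary_representation G \<sigma> \<and>
     (\<forall>W. complex_vector.subspace W \<and> (\<forall>g. \<sigma> g ` W \<subseteq> W) \<longrightarrow> W = {0} \<or> W = UNIV)"

definition differential ::
    "('g::topological_space, 'e::euclidean_space) lie_group \<Rightarrow>
      ('g \<Rightarrow> 'h \<Rightarrow> 'h::complex_euclidean_space) \<Rightarrow> 'e \<Rightarrow> 'h \<Rightarrow> 'h" where
  "differential G \<sigma> X u = vector_derivative (\<lambda>t. \<sigma> (lie_exp G (t *\<^sub>R X)) u) (at 0)"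

text \<open>A highest-weight vector is a nonzero weight vector annihilated by the positive root spaces;
  an irreducible representation has highest weight \<open>\<nu>\<close> if it contains one of weight \<open>\<nu>\<close>.\<close>

definition highest_weight_vector ::
    "('g::topological_space, 'e::euclidean_space) lie_group \<Rightarrow> 'g set \<Rightarrow> ('e \<Rightarrow> complex) set \<Rightarrow>
      ('g \<Rightarrow> 'h \<Rightarrow> 'h::complex_euclidean_space) \<Rightarrow> ('e \<Rightarrow> complex) \<Rightarrow> 'h \<Rightarrow> bool" where
  "highest_weight_vector G T P \<sigma> \<nu> v \<longleftrightarrow>
     v \<noteq> 0 \<and>
     (\<forall>H\<in>torus_algebra G T. differential G \<sigma> H v = \<nu> H *\<^sub>C v) \<and>
     (\<forall>\<alpha>\<in>P. \<forall>(X, Y)\<in>root_space G T \<alpha>. differential G \<sigma> X v + \<i> *\<^sub>C differential G \<sigma> Y v = 0)"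


section \<open>Haar measure, convolution and \<open>L\<^sup>p\<close> spaces\<close>

definition normalized_haar_measure ::
    "('g::topological_space, 'e::euclidean_space) lie_group \<Rightarrow> 'g measure \<Rightarrow> bool" where
  "normalized_haar_measure G \<mu> \<longleftrightarrow>
     sets \<mu> = sets borel \<and> prob_space \<mu> \<and> (\<forall>g. distr \<mu> \<mu> (\<lambda>x. g \<otimes>\<^bsub>G\<^esub> x) = \<mu>)"

definition group_convolution ::
    "('g::topological_space, 'e::euclidean_space) lie_group \<Rightarrow> 'g measure \<Rightarrow>
      ('g \<Rightarrow> complex) \<Rightarrow> ('g \<Rightarrow> complex) \<Rightarrow> 'g \<Rightarrow> complex" where
  "group_convolution G \<mu> f h x = (\<integral>y. f y * h (inv\<^bsub>G\<^esub> y \<otimes>\<^bsub>G\<^esub> x) \<partial>\<mu>)"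

definition Lp_norm :: "'a measure \<Rightarrow> ennreal \<Rightarrow> ('a \<Rightarrow> complex) \<Rightarrow> ennreal" where
  "Lp_norm M p f =
     (if p = \<infinity> then esssup M (\<lambda>x. ennreal (cmod (f x)))
      else let I = (\<integral>\<^sup>+x. ennreal (cmod (f x) powr enn2real p) \<partial>M)
           in if I = \<infinity> then \<infinity> else ennreal (enn2real I powr (1 / enn2real p)))"

text \<open>\<open>Lp_quotient G \<mu> L p\<close> is \<open>L\<^sup>p(G/L)\<close>. Functions on \<open>G/L\<close> are right-\<open>L\<close>-invariant functions on
  \<open>G\<close>; as the invariant probability measure on \<open>G/L\<close> is the image of the Haar measure, their norm
  may be computed on \<open>G\<close>. Elements are functions, not classes modulo null functions.\<close>

definition Lp_quotient ::
    "('g::topological_space, 'e::euclidean_space) lie_group \<Rightarrow> 'g measure \<Rightarrow> 'g set \<Rightarrow> ennreal \<Rightarrow>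
      ('g \<Rightarrow> complex) set" where
  "Lp_quotient G \<mu> L p =
     {f \<in> borel_measurable \<mu>. (\<forall>x. \<forall>l\<in>L. f (x \<otimes>\<^bsub>G\<^esub> l) = f x) \<and> Lp_norm \<mu> p f < \<infinity>}"

definition op_norm ::
    "'a measure \<Rightarrow> ennreal \<Rightarrow> ('a \<Rightarrow> complex) set \<Rightarrow> (('a \<Rightarrow> complex) \<Rightarrow> 'a \<Rightarrow> complex) \<Rightarrow> ennreal" where
  "op_norm M p V A = (SUP f\<in>{f \<in> V. Lp_norm M p f \<le> 1}. Lp_norm M p (A f))"

text \<open>An operator on \<open>L\<^sup>p(G/L)\<close>: a linear map, compatible with equality almost everywhere.\<close>

definition Lp_quotient_operator ::
    "('g::topological_space, 'e::euclidean_space) lie_group \<Rightarrow> 'g measure \<Rightarrow> 'g set \<Rightarrow> ennreal \<Rightarrow>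
      (('g \<Rightarrow> complex) \<Rightarrow> 'g \<Rightarrow> complex) \<Rightarrow> bool" where
  "Lp_quotient_operator G \<mu> L p A \<longleftrightarrow>
     (\<forall>f\<in>Lp_quotient G \<mu> L p. A f \<in> Lp_quotient G \<mu> L p) \<and>
     (\<forall>f\<in>Lp_quotient G \<mu> L p. \<forall>h\<in>Lp_quotient G \<mu> L p. \<forall>a b.
        AE x in \<mu>. A (\<lambda>y. a * f y + b * h y) x = a * A f x + b * A h x) \<and>
     (\<forall>f\<in>Lp_quotient G \<mu> L p. \<forall>h\<in>Lp_quotient G \<mu> L p.
        (AE x in \<mu>. f x = h x) \<longrightarrow> (AE x in \<mu>. A f x = A h x))"


section \<open>Toeplitz operators and the Berezin transform\<close>

definition weight_stabilizer :: "('g \<Rightarrow> 'h \<Rightarrow> 'h::complex_euclidean_space) \<Rightarrow> 'h \<Rightarrow> 'g set" where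
  "weight_stabilizer \<sigma> v = {g. \<exists>c. \<sigma> g v = c *\<^sub>C v}"

definition matrix_coeff :: "('g \<Rightarrow> 'h \<Rightarrow> 'h::complex_euclidean_space) \<Rightarrow> 'h \<Rightarrow> 'g \<Rightarrow> complex" where
  "matrix_coeff \<sigma> v g = cinner v (\<sigma> g v)"

definition toeplitz ::
    "'g measure \<Rightarrow> ('g \<Rightarrow> 'h \<Rightarrow> 'h::complex_euclidean_space) \<Rightarrow> 'h \<Rightarrow> ('g \<Rightarrow> complex) \<Rightarrow> 'h \<Rightarrow> 'h" where
  "toeplitz \<mu> \<sigma> v f =
     (THE A. Vector_Spaces.linear scaleC scaleC A \<and>
        (\<forall>u w. cinner (A u) w =
           of_nat (cdim TYPE('h)) *
             (\<integral>y. f y * cinner u (\<sigma> y v) * cnj (cinner w (\<sigma> y v)) \<partial>\<mu>)))"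

definition berezin ::
    "'g measure \<Rightarrow> ('g \<Rightarrow> 'h \<Rightarrow> 'h::complex_euclidean_space) \<Rightarrow> 'h \<Rightarrow> ('g \<Rightarrow> complex) \<Rightarrow> 'g \<Rightarrow> complex"
  where
  "berezin \<mu> \<sigma> v f x = cinner (toeplitz \<mu> \<sigma> v f (\<sigma> x v)) (\<sigma> x v)"

end

theory Submission
  imports Defs
begin

text \<open>The Berezin transform is integration against the kernel
  \<open>k x y = d |\<langle>\<sigma> x v, \<sigma> y v\<rangle>|\<^sup>2\<close>, which is nonnegative and symmetric. By Schur orthogonality its
  integral over either variable is 1, so Jensen's inequality and Tonelli's theorem make it a
  contraction on every \<open>L\<^sup>p\<close>. For Schur orthogonality, the operator
  \<open>u \<mapsto> \<integral> \<langle>u, \<sigma> y v\<rangle> \<sigma> y v dy\<close> is self-adjoint and commutes with \<open>\<sigma>\<close>; its top eigenspace, found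
  by maximizing the Rayleigh quotient, is therefore the whole space, and its trace is 1.\<close>

section \<open>Stochastic kernels on \<open>L\<^sup>p\<close>\<close>

text \<open>A convex function lies above its tangents. Scaling to \<open>t = a * s\<close> reduces
  the claim to Bernoulli's inequality \<open>1 + p * (s - 1) \<le> s powr p\<close>.\<close>

lemma powr_tangent_le:
  fixes a t p :: real
  assumes "1 \<le> p" "0 < a" "0 \<le> t"
  shows "a powr p + p * a powr (p - 1) * (t - a) \<le> t powr p"
proof -
  have ap: "a powr p = a powr (p - 1) * a"
    using assms by (simp add: powr_diff)
  show ?thesis
  proof (cases "t = 0")
    case True
    from ap have "a powr p + p * a powr (p - 1) * (t - a) = - ((p - 1) * a powr p)"
      using True by (simp add: algebra_simps)
    also have "\<dots> \<le> 0" using assms by simp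
    finally show ?thesis using True by simp
  next
    case False
    define s where "s = t / a"
    have s: "s > 0" "t = a * s" using assms False by (auto simp: s_def)
    \<comment> \<open>Young's inequality with weights \<open>1/p\<close> and \<open>1 - 1/p\<close>
      and second factor 1; multiplication by \<open>p\<close> turns it into Bernoulli's
      inequality.\<close>
    have "(s powr p) powr (1/p) * 1 powr (1 - 1/p) \<le> 1/p * s powr p + (1 - 1/p) * 1"
      using assms s by (intro Youngs_inequality_0) auto
    moreover have "(s powr p) powr (1/p) * 1 powr (1 - 1/p) = s"
      using assms s by (simp add: powr_powr)
    ultimately have "s \<le> 1/p * s powr p + (1 - 1/p)" by simp
    from mult_left_mono[OF this, of p] have "p * s \<le> p * (1/p * s powr p + (1 - 1/p))"
      using assms by simp
    also have "\<dots> = s powr p + (p - 1)" using assms by (simp add: distrib_left right_diff_distrib)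
    finally have 1: "1 + p * (s - 1) \<le> s powr p" by (simp add: algebra_simps)
    have "p * a powr (p - 1) * (t - a) = a powr p * (p * (s - 1))"
      unfolding s(2) ap by (simp add: algebra_simps)
    then have "a powr p + p * a powr (p - 1) * (t - a) = a powr p * (1 + p * (s - 1))"
      by (simp add: distrib_left)
    also have "\<dots> \<le> a powr p * s powr p" using 1 by (rule mult_left_mono) simp
    also have "\<dots> = t powr p" using assms s by (simp add: powr_mult)
    finally show ?thesis .
  qed
qed

text \<open>Jensen's inequality for the probability measure with density \<open>k\<close>, obtained
  by integrating the tangent inequality at the mean \<open>a\<close>.\<close>

lemma powr_integral_le:
  fixes t k :: "'a \<Rightarrow> real"
  assumes p: "1 \<le> p" and t: "\<And>x. 0 \<le> t x" and k: "\<And>x. 0 \<le> k x"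
    and "integrable M k" "(\<integral>x. k x \<partial>M) = 1"
    and "integrable M (\<lambda>x. t x * k x)" "integrable M (\<lambda>x. t x powr p * k x)"
  shows "(\<integral>x. t x * k x \<partial>M) powr p \<le> (\<integral>x. t x powr p * k x \<partial>M)"
proof -
  define a where "a = (\<integral>x. t x * k x \<partial>M)"
  have "0 \<le> a" unfolding a_def using t k by (intro integral_nonneg_AE) auto
  \<comment> \<open>The tangent inequality needs a positive base point; for mean 0 the left side is
    \<open>0 powr p = 0\<close>.\<close>
  then consider "a = 0" | "0 < a" by linarith
  then show ?thesis
  proof cases
    case 1
    then show ?thesis unfolding a_def[symmetric] using t k by simp
  next
    case 2
    let ?c = "p * a powr (p - 1)"
    \<comment> \<open>Since \<open>k\<close> has integral 1 and \<open>t * k\<close> has integral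
      \<open>a\<close>, the linear term of the tangent integrates to 0.\<close>
    have "a powr p = (\<integral>x. (a powr p - ?c * a) * k x + ?c * (t x * k x) \<partial>M)"
      using assms by (simp add: a_def[symmetric])
    also have "\<dots> \<le> (\<integral>x. t x powr p * k x \<partial>M)"
    proof (rule integral_mono)
      fix x
      show "(a powr p - ?c * a) * k x + ?c * (t x * k x) \<le> t x powr p * k x"
        using mult_right_mono[OF powr_tangent_le[OF p 2 t] k, of x x] by (simp add: algebra_simps)
    qed (use assms in auto)
    finally show ?thesis unfolding a_def[symmetric] .
  qed
qed

section \<open>\<open>L\<^sup>p\<close> norms and integrability\<close>

lemma Lp_norm_infinity: "Lp_norm M \<infinity> f = esssup M (\<lambda>x. ennreal (cmod (f x)))"
  by (simp add: Lp_norm_def)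

lemma Lp_norm_finite_exponent:
  assumes "p \<noteq> \<infinity>"
  shows "Lp_norm M p f =
    (if (\<integral>\<^sup>+x. ennreal (cmod (f x) powr enn2real p) \<partial>M) = \<infinity> then \<infinity>
     else ennreal (enn2real (\<integral>\<^sup>+x. ennreal (cmod (f x) powr enn2real p) \<partial>M) powr (1 / enn2real p)))"
  using assms by (simp add: Lp_norm_def Let_def)

lemma Lp_norm_less_infinity_iff:
  assumes "p \<noteq> \<infinity>"
  shows "Lp_norm M p f < \<infinity> \<longleftrightarrow> (\<integral>\<^sup>+x. ennreal (cmod (f x) powr enn2real p) \<partial>M) < \<infinity>"
  using assms by (auto simp: Lp_norm_finite_exponent less_top)

lemma one_le_enn2real:
  assumes "1 \<le> p" "p \<noteq> \<infinity>"
  shows "1 \<le> enn2real p"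
  using assms enn2real_mono[of 1 p] by (simp add: less_top)

text \<open>Constants are integrable for a finite measure. An integrable majorant of
  \<open>cmod (f x)\<close> is thus the essential bound if \<open>p = \<infinity>\<close>, and
  \<open>1 + cmod (f x) powr q\<close> otherwise.\<close>

lemma (in finite_measure) integrable_Lp:
  fixes f :: "'a \<Rightarrow> complex"
  assumes p: "1 \<le> p" and [measurable]: "f \<in> borel_measurable M" and "Lp_norm M p f < \<infinity>"
  shows "integrable M f"
proof (cases "p = \<infinity>")
  case True
  define c where "c = enn2real (Lp_norm M p f)"
  have "AE x in M. ennreal (cmod (f x)) \<le> Lp_norm M p f"
    unfolding True Lp_norm_infinity by (rule esssup_AE)
  moreover have "Lp_norm M p f = ennreal c" "0 \<le> c"
    unfolding c_def using assms by (simp_all add: less_top)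
  ultimately have "AE x in M. cmod (f x) \<le> c" by simp
  then show ?thesis by (intro integrable_const_bound) auto
next
  case False
  define q where "q = enn2real p"
  have q: "1 \<le> q" unfolding q_def using p False by (rule one_le_enn2real)
  have intq: "integrable M (\<lambda>x. cmod (f x) powr q)"
    using assms False unfolding Lp_norm_less_infinity_iff[OF False] q_def
    by (intro integrableI_bounded) auto
  have le: "norm (f x) \<le> norm (1 + cmod (f x) powr q)" for x
  proof (cases "cmod (f x) \<le> 1")
    case True
    then show ?thesis by (smt (verit) powr_ge_zero real_norm_def)
  next
    case False
    then have "cmod (f x) powr 1 \<le> cmod (f x) powr q" using q by (intro powr_mono) auto
    then show ?thesis using False by simp
  qed
  have "integrable M (\<lambda>x. 1 + cmod (f x) powr q)"
    using intq by (intro Bochner_Integration.integrable_add) simp_all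
  then show ?thesis by (rule Bochner_Integration.integrable_bound) (use le in \<open>simp_all\<close>)
qed

lemma integrable_mult_bounded:
  fixes f h :: "'a \<Rightarrow> 'b::{banach, second_countable_topology, real_normed_algebra}"
  assumes f: "integrable M f" and [measurable]: "h \<in> borel_measurable M"
    and h: "\<And>x. norm (h x) \<le> K"
  shows "integrable M (\<lambda>x. f x * h x)"
proof (rule Bochner_Integration.integrable_bound)
  show "integrable M (\<lambda>x. K * norm (f x))" using f by auto
  have "norm (f x * h x) \<le> norm (K * norm (f x))" for x
  proof -
    have "norm (f x * h x) \<le> norm (f x) * norm (h x)" by (rule norm_mult_ineq)
    also have "\<dots> \<le> norm (f x) * K" by (intro mult_left_mono h) simp
    finally show ?thesis by (simp add: mult.commute)
  qed
  then show "AE x in M. norm (f x * h x) \<le> norm (K * norm (f x))" by simp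
  have [measurable]: "f \<in> borel_measurable M" using f by auto
  show "(\<lambda>x. f x * h x) \<in> borel_measurable M" by measurable
qed

text \<open>Only one of the two marginal integrals is prescribed, since symmetry yields the other.
  The bound \<open>C\<close> keeps the product of an integrable function with \<open>k x\<close>
  integrable. Measurability of \<open>k x\<close> is stated for every \<open>x\<close> of the type,
  which need not lie in \<open>space M\<close>.\<close>

locale symmetric_stochastic_kernel = prob_space M for M :: "'a measure" +
  fixes k :: "'a \<Rightarrow> 'a \<Rightarrow> real" and C :: real
  assumes kernel_measurable [measurable]: "case_prod k \<in> borel_measurable (M \<Otimes>\<^sub>M M)"
    and kernel_nonneg: "0 \<le> k x y" and kernel_le: "k x y \<le> C"
    and kernel_commute: "k x y = k y x"
    and kernel_integral: "(\<integral>y. k x y \<partial>M) = 1"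
    and kernel_measurable_2 [measurable]: "k x \<in> borel_measurable M"
begin

section \<open>Averages against a symmetric stochastic kernel\<close>

lemma kernel_integrable:
  fixes f :: "'a \<Rightarrow> 'b::{banach, second_countable_topology, real_normed_algebra_1}"
  assumes "integrable M f"
  shows "integrable M (\<lambda>y. f y * of_real (k x y))"
  using kernel_nonneg kernel_le
  by (intro integrable_mult_bounded[OF assms, of _ C]) auto

lemma integrable_kernel: "integrable M (k x)"
  using kernel_integrable[of "\<lambda>_. 1::real"] by simp

lemma nn_integral_kernel: "(\<integral>\<^sup>+y. ennreal (k x y) \<partial>M) = 1"
  using nn_integral_eq_integral[OF integrable_kernel, of x] kernel_nonneg kernel_integral by simp

lemma cmod_kernel_integral_le:
  fixes f :: "'a \<Rightarrow> complex"
  shows "cmod (\<integral>y. f y * of_real (k x y) \<partial>M) \<le> (\<integral>y. cmod (f y) * k x y \<partial>M)"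
proof -
  have "cmod (\<integral>y. f y * of_real (k x y) \<partial>M) \<le> (\<integral>y. cmod (f y * of_real (k x y)) \<partial>M)"
    by (rule integral_norm_bound)
  then show ?thesis by (simp add: norm_mult kernel_nonneg)
qed

text \<open>An average of values bounded by \<open>c\<close> is bounded by \<open>c\<close>. The
  average obeys the bound at every \<open>x\<close>, although \<open>f\<close> obeys it only almost
  everywhere.\<close>

lemma esssup_kernel_integral_le:
  fixes f :: "'a \<Rightarrow> complex"
  assumes [measurable]: "f \<in> borel_measurable M"
    and [measurable]: "(\<lambda>x. \<integral>y. f y * of_real (k x y) \<partial>M) \<in> borel_measurable M"
    and fin: "Lp_norm M \<infinity> f < \<infinity>"
  shows "Lp_norm M \<infinity> (\<lambda>x. \<integral>y. f y * of_real (k x y) \<partial>M) \<le> Lp_norm M \<infinity> f"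
proof -
  define c where "c = enn2real (Lp_norm M \<infinity> f)"
  have c: "Lp_norm M \<infinity> f = ennreal c" "0 \<le> c" unfolding c_def using fin by (auto simp: less_top)
  have "AE y in M. ennreal (cmod (f y)) \<le> Lp_norm M \<infinity> f"
    unfolding Lp_norm_infinity by (rule esssup_AE)
  then have ae: "AE y in M. cmod (f y) \<le> c" using c by simp
  have int: "integrable M f" using fin by (intro integrable_Lp[of \<infinity>]) auto
  have "cmod (\<integral>y. f y * of_real (k x y) \<partial>M) \<le> c" for x
  proof -
    have "(\<integral>y. cmod (f y) * k x y \<partial>M) \<le> (\<integral>y. c * k x y \<partial>M)"
      using ae kernel_integrable[OF integrable_norm[OF int], of x] integrable_kernel
      by (intro integral_mono_AE) (auto intro!: mult_right_mono kernel_nonneg)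
    also have "\<dots> = c" by (simp add: kernel_integral)
    finally show ?thesis using cmod_kernel_integral_le[of f x] by linarith
  qed
  then show ?thesis unfolding c(1) unfolding Lp_norm_infinity
    by (intro esssup_I) (auto intro!: ennreal_leI)
qed

text \<open>Jensen's inequality for the density \<open>k x\<close> bounds the integrand at each
  \<open>x\<close>. After Tonelli's theorem the remaining inner integral runs over the first
  argument of \<open>k\<close>, and is 1 by symmetry.\<close>

lemma nn_integral_powr_kernel_le:
  fixes f :: "'a \<Rightarrow> complex"
  assumes q: "1 \<le> q" and [measurable]: "f \<in> borel_measurable M" and int: "integrable M f"
    and fin: "(\<integral>\<^sup>+x. ennreal (cmod (f x) powr q) \<partial>M) < \<infinity>"
  shows "(\<integral>\<^sup>+x. ennreal (cmod (\<integral>y. f y * of_real (k x y) \<partial>M) powr q) \<partial>M)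
    \<le> (\<integral>\<^sup>+x. ennreal (cmod (f x) powr q) \<partial>M)"
proof -
  interpret pair_sigma_finite M M ..
  have intq: "integrable M (\<lambda>x. cmod (f x) powr q)"
    using fin by (intro integrableI_bounded) auto
  have "ennreal (cmod (\<integral>y. f y * of_real (k x y) \<partial>M) powr q)
      \<le> (\<integral>\<^sup>+y. ennreal (cmod (f y) powr q) * ennreal (k x y) \<partial>M)" for x
  proof -
    have "cmod (\<integral>y. f y * of_real (k x y) \<partial>M) powr q \<le> (\<integral>y. cmod (f y) * k x y \<partial>M) powr q"
      using q by (intro powr_mono2 cmod_kernel_integral_le) auto
    also have "\<dots> \<le> (\<integral>y. cmod (f y) powr q * k x y \<partial>M)"
      using q kernel_integrable[OF integrable_norm[OF int], of x] kernel_integrable[OF intq, of x]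
        integrable_kernel kernel_integral kernel_nonneg
      by (intro powr_integral_le) auto
    finally have "ennreal (cmod (\<integral>y. f y * of_real (k x y) \<partial>M) powr q)
        \<le> ennreal (\<integral>y. cmod (f y) powr q * k x y \<partial>M)" by (rule ennreal_leI)
    also have "\<dots> = (\<integral>\<^sup>+y. ennreal (cmod (f y) powr q * k x y) \<partial>M)"
      using kernel_integrable[OF intq, of x] kernel_nonneg
      by (intro nn_integral_eq_integral[symmetric]) auto
    finally show ?thesis using kernel_nonneg by (simp add: ennreal_mult)
  qed
  then have "(\<integral>\<^sup>+x. ennreal (cmod (\<integral>y. f y * of_real (k x y) \<partial>M) powr q) \<partial>M)
      \<le> (\<integral>\<^sup>+x. \<integral>\<^sup>+y. ennreal (cmod (f y) powr q) * ennreal (k x y) \<partial>M \<partial>M)"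
    by (intro nn_integral_mono)
  also have "\<dots> = (\<integral>\<^sup>+y. \<integral>\<^sup>+x. ennreal (cmod (f y) powr q) * ennreal (k x y) \<partial>M \<partial>M)"
    by (rule Fubini') measurable
  also have "\<dots> = (\<integral>\<^sup>+y. ennreal (cmod (f y) powr q) * (\<integral>\<^sup>+x. ennreal (k y x) \<partial>M) \<partial>M)"
    by (subst kernel_commute) (simp add: nn_integral_cmult)
  also have "\<dots> = (\<integral>\<^sup>+y. ennreal (cmod (f y) powr q) \<partial>M)"
    by (simp add: nn_integral_kernel)
  finally show ?thesis .
qed

lemma Lp_norm_kernel_integral_le:
  fixes f :: "'a \<Rightarrow> complex"
  assumes p: "1 \<le> p" and f: "f \<in> borel_measurable M"
    and Kf: "(\<lambda>x. \<integral>y. f y * of_real (k x y) \<partial>M) \<in> borel_measurable M"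
    and fin: "Lp_norm M p f < \<infinity>"
  shows "Lp_norm M p (\<lambda>x. \<integral>y. f y * of_real (k x y) \<partial>M) \<le> Lp_norm M p f"
proof (cases "p = \<infinity>")
  case True
  then show ?thesis using esssup_kernel_integral_le[OF f Kf] fin by simp
next
  case False
  define q where "q = enn2real p"
  have q: "1 \<le> q" unfolding q_def using p False by (rule one_le_enn2real)
  have fin': "(\<integral>\<^sup>+x. ennreal (cmod (f x) powr q) \<partial>M) < \<infinity>"
    using fin unfolding Lp_norm_less_infinity_iff[OF False] q_def .
  have le: "(\<integral>\<^sup>+x. ennreal (cmod (\<integral>y. f y * of_real (k x y) \<partial>M) powr q) \<partial>M)
    \<le> (\<integral>\<^sup>+x. ennreal (cmod (f x) powr q) \<partial>M)"
    by (rule nn_integral_powr_kernel_le[OF q f integrable_Lp[OF p f fin] fin'])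
  show ?thesis
    \<comment> \<open>\<open>le\<close> and \<open>fin'\<close> make both integrals finite, so
      neither norm takes its infinite branch and monotonicity of the \<open>q\<close>-th root
      applies.\<close>
    unfolding Lp_norm_finite_exponent[OF False] q_def[symmetric]
    using le fin' q by (auto simp: top_unique intro!: ennreal_leI powr_mono2 enn2real_mono)
qed

end

section \<open>Complex inner products\<close>

lemma cinner_add_right: "cinner x (y + z) = cinner x y + cinner x z"
  by (metis cinner_add_left cinner_commute complex_cnj_add)

lemma cinner_scaleC_right: "cinner x (a *\<^sub>C y) = cnj a * cinner x y"
  by (metis cinner_scaleC_left cinner_commute complex_cnj_mult)

lemma Im_cinner: "Im (cinner x y) = inner x (\<i> *\<^sub>C y)"
  by (simp add: cinner_scaleC_right flip: Re_cinner)

lemma cinner_self: "cinner x x = complex_of_real ((norm x)\<^sup>2)"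
proof (rule complex_eqI)
  have "Im (cinner x x) = - Im (cinner x x)"
    by (subst (1) cinner_commute) simp
  then show "Im (cinner x x) = Im (complex_of_real ((norm x)\<^sup>2))" by simp
qed (simp add: Re_cinner power2_norm_eq_inner)

lemma norm_scaleC: "norm (a *\<^sub>C (x::'a::complex_euclidean_space)) = cmod a * norm x"
proof -
  have "complex_of_real ((norm (a *\<^sub>C x))\<^sup>2) = (a * cnj a) * complex_of_real ((norm x)\<^sup>2)"
    unfolding cinner_self[symmetric] by (simp add: cinner_scaleC_left cinner_scaleC_right)
  also have "\<dots> = complex_of_real ((cmod a * norm x)\<^sup>2)"
    by (simp add: power_mult_distrib flip: complex_norm_square)
  finally show ?thesis by (simp only: of_real_eq_iff) (simp add: power2_eq_iff_nonneg)
qed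

text \<open>Multiplying \<open>x\<close> by the conjugate of \<open>cinner x y\<close> makes the
  inner product real and nonnegative, so that the real Cauchy-Schwarz inequality applies.\<close>

lemma cmod_cinner_le: "cmod (cinner x y) \<le> norm x * norm y"
proof (cases "cinner x y = 0")
  case False
  define c where "c = cinner x y"
  have "cmod c * cmod c = Re (cnj c * c)"
    by (simp add: cmod_power2 flip: power2_eq_square)
  also have "\<dots> = inner (cnj c *\<^sub>C x) y"
    by (simp add: c_def cinner_scaleC_left flip: Re_cinner)
  also have "\<dots> \<le> norm (cnj c *\<^sub>C x) * norm y" by (rule norm_cauchy_schwarz)
  also have "\<dots> = cmod c * (norm x * norm y)" by (simp add: norm_scaleC)
  finally show ?thesis using False unfolding c_def[symmetric] by simp
qed simp

text \<open>The real part of \<open>cinner\<close> is the real inner product, which is already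
  nondegenerate. Vector identities below are therefore checked weakly, against all
  \<open>w\<close>.\<close>

lemma cinner_eqI:
  assumes "\<And>w. cinner x w = cinner y w"
  shows "x = y"
proof -
  have "inner x w = inner y w" for w using assms by (simp flip: Re_cinner)
  then show ?thesis by (rule vector_eq_rdot[THEN iffD1, rule_format])
qed

section \<open>Boundedness and measurability of the complex operations\<close>

lemma scaleC_scaleR: "a *\<^sub>C (r *\<^sub>R x) = r *\<^sub>R (a *\<^sub>C (x::'a::complex_euclidean_space))"
  by (simp add: scaleC_scaleC mult.commute flip: scaleC_of_real)

lemma bounded_bilinear_scaleC:
  "bounded_bilinear (scaleC :: complex \<Rightarrow> 'a \<Rightarrow> 'a::complex_euclidean_space)"
proof
  show "\<exists>K. \<forall>a (x::'a). norm (a *\<^sub>C x) \<le> norm a * norm x * K"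
    by (rule exI[of _ 1]) (simp add: norm_scaleC)
  show "(r *\<^sub>R a) *\<^sub>C x = r *\<^sub>R (a *\<^sub>C x)" for r a and x :: 'a
    by (simp only: scaleR_conv_of_real scaleC_of_real[symmetric] scaleC_scaleC)
qed (simp_all add: scaleC_add_left scaleC_add_right scaleC_scaleR)

lemma bounded_bilinear_cinner:
  "bounded_bilinear (cinner :: 'a \<Rightarrow> 'a::complex_euclidean_space \<Rightarrow> complex)"
proof
  show "\<exists>K. \<forall>(x::'a) y. norm (cinner x y) \<le> norm x * norm y * K"
    by (rule exI[of _ 1]) (simp add: cmod_cinner_le)
qed (simp_all add: cinner_add_left cinner_add_right cinner_scaleC_left cinner_scaleC_right
      scaleR_conv_of_real flip: scaleC_of_real)

lemmas continuous_on_cinner [continuous_intros] =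
  bounded_bilinear.continuous_on[OF bounded_bilinear_cinner]

lemma borel_measurable_cinner [measurable (raw)]:
  fixes f g :: "'a \<Rightarrow> 'b::complex_euclidean_space"
  assumes "f \<in> borel_measurable M" "g \<in> borel_measurable M"
  shows "(\<lambda>x. cinner (f x) (g x)) \<in> borel_measurable M"
  using assms by (rule borel_measurable_continuous_Pair) (intro continuous_intros)

lemma borel_measurable_scaleC [measurable (raw)]:
  fixes f :: "'a \<Rightarrow> complex" and g :: "'a \<Rightarrow> 'b::complex_euclidean_space"
  assumes "f \<in> borel_measurable M" "g \<in> borel_measurable M"
  shows "(\<lambda>x. f x *\<^sub>C g x) \<in> borel_measurable M"
  using assms by (rule borel_measurable_continuous_Pair)
    (intro bounded_bilinear.continuous_on[OF bounded_bilinear_scaleC] continuous_intros)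

text \<open>\<open>Basis\<close> is an orthonormal basis over the reals. The real and imaginary
  parts of \<open>cinner b w\<close> are the real inner products of \<open>b\<close> with
  \<open>w\<close> and with \<open>\<i> *\<^sub>C w\<close>; Parseval for each of these vectors
  accounts for the factor 2.\<close>

lemma sum_Basis_cmod_cinner:
  "(\<Sum>b\<in>Basis. (cmod (cinner b w))\<^sup>2) = 2 * (norm (w::'a::complex_euclidean_space))\<^sup>2"
proof -
  have parseval: "(\<Sum>b\<in>Basis. (inner b x)\<^sup>2) = (norm x)\<^sup>2" for x :: 'a
    unfolding power2_norm_eq_inner
    by (subst euclidean_inner) (simp add: power2_eq_square inner_commute)
  have "(\<Sum>b\<in>Basis. (cmod (cinner b w))\<^sup>2)
      = (\<Sum>b\<in>Basis. (inner b w)\<^sup>2) + (\<Sum>b\<in>Basis. (inner b (\<i> *\<^sub>C w))\<^sup>2)"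
    by (simp add: cmod_power2 Re_cinner Im_cinner sum.distrib)
  then show ?thesis by (simp add: parseval norm_scaleC)
qed

section \<open>Real and complex dimension\<close>

lemma independent_complex_imp_real:
  assumes "\<not> complex_vector.dependent (B::'a::complex_euclidean_space set)"
  shows "independent B"
proof
  assume "dependent B"
  then obtain t u where t: "finite t" "t \<subseteq> B" "(\<Sum>v\<in>t. u v *\<^sub>R v) = 0" "\<exists>v\<in>t. u v \<noteq> 0"
    unfolding real_vector.dependent_explicit by blast
  have "(\<Sum>v\<in>t. complex_of_real (u v) *\<^sub>C v) = 0" using t by (simp add: scaleC_of_real)
  with t have "complex_vector.dependent B"
    unfolding complex_vector.dependent_explicit
    by (intro exI[of _ t] exI[of _ "\<lambda>v. complex_of_real (u v)"]) auto
  with assms show False by simp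
qed

text \<open>A complex basis \<open>B\<close> together with its multiple by \<open>\<i>\<close> is a
  real basis. The formula converts a trace over the real \<open>Basis\<close> into a complex
  one.\<close>

lemma DIM_eq_cdim: "DIM('a::complex_euclidean_space) = 2 * cdim TYPE('a)"
proof -
  obtain B :: "'a set" where B: "\<not> complex_vector.dependent B" "UNIV \<subseteq> complex_vector.span B"
      "card B = cdim TYPE('a)"
    unfolding cdim_def by (rule complex_vector.basis_exists[of UNIV]) auto
  \<comment> \<open>A complex independent set is independent over the reals, so the real dimension
    bounds its size.\<close>
  have fin: "finite B"
    using independent_bound[OF independent_complex_imp_real[OF B(1)]] by simp
  have zeroD: "u b = 0" if "(\<Sum>b\<in>B. u b *\<^sub>C b) = 0" "b \<in> B" for u b
    using B(1) that unfolding complex_vector.dependent_finite[OF fin] by blast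
  let ?J = "scaleC \<i> :: 'a \<Rightarrow> 'a"
  have J: "inj_on ?J B" by (rule inj_onI) (simp add: complex_vector.scale_left_imp_eq)
  have decomp: "a *\<^sub>C x = Re a *\<^sub>R x + Im a *\<^sub>R ?J x" for a and x :: 'a
    by (metis complex_eq scaleC_add_left scaleC_of_real scaleC_scaleC mult.commute)
  have disj: "B \<inter> ?J ` B = {}"
  proof (rule ccontr)
    assume "B \<inter> ?J ` B \<noteq> {}"
    then obtain b c where bc: "b \<in> B" "c \<in> B" "b = \<i> *\<^sub>C c" by auto
    \<comment> \<open>The coefficients of the relation \<open>b - \<i> *\<^sub>C c = 0\<close>. The
      one at \<open>c\<close> is \<open>1 - \<i>\<close> or \<open>- \<i>\<close>, according to
      whether \<open>b = c\<close>, and so never 0.\<close>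
    define u where "u = (\<lambda>x. (if x = b then 1 else 0) - (if x = c then \<i> else (0::complex)))"
    have "(\<Sum>x\<in>B. u x *\<^sub>C x) = b - \<i> *\<^sub>C c"
      using bc(1,2) fin
      by (simp add: u_def complex_vector.scale_left_diff_distrib sum_subtractf if_distrib[of "\<lambda>a. a *\<^sub>C _"] cong: if_cong)
    then have "u c = 0" using bc zeroD[of u c] by simp
    then show False by (auto simp: u_def split: if_splits simp: complex_eq_iff)
  qed
  have "DIM('a) = card (B \<union> ?J ` B)"
    unfolding dim_UNIV[symmetric]
  proof (rule dim_unique)
    show "UNIV \<subseteq> span (B \<union> ?J ` B)"
    proof
      fix x :: 'a
      from B(2) have "x \<in> complex_vector.span B" by auto
      then obtain u where "x = (\<Sum>b\<in>B. u b *\<^sub>C b)"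
        unfolding complex_vector.span_finite[OF fin] by auto
      also have "\<dots> = (\<Sum>b\<in>B. Re (u b) *\<^sub>R b + Im (u b) *\<^sub>R ?J b)"
        by (rule sum.cong[OF refl decomp])
      finally show "x \<in> span (B \<union> ?J ` B)"
        by (simp only:) (intro span_sum span_add span_scale span_base; blast)
    qed
    show "independent (B \<union> ?J ` B)"
    proof
      assume "dependent (B \<union> ?J ` B)"
      then obtain u w where w: "w \<in> B \<union> ?J ` B" "u w \<noteq> 0"
        and sum: "(\<Sum>w\<in>B \<union> ?J ` B. u w *\<^sub>R w) = 0"
        unfolding real_vector.dependent_finite[OF finite_UnI[OF fin finite_imageI[OF fin]]] by blast
      \<comment> \<open>The real coefficients at \<open>b\<close> and at
        \<open>\<i> *\<^sub>C b\<close> merge into one complex coefficient at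
        \<open>b\<close>.\<close>
      have "(\<Sum>b\<in>B. Complex (u b) (u (?J b)) *\<^sub>C b) = (\<Sum>w\<in>B \<union> ?J ` B. u w *\<^sub>R w)"
        using fin disj J by (simp add: decomp[of "Complex _ _"] sum.distrib sum.union_disjoint sum.reindex)
      with sum have "b \<in> B \<Longrightarrow> Complex (u b) (u (?J b)) = 0" for b
        using zeroD[of "\<lambda>b. Complex (u b) (u (?J b))"] by simp
      with w show False by (auto simp: Complex_eq_0)
    qed
  qed auto
  also have "\<dots> = 2 * card B"
    using fin disj J by (simp add: card_Un_disjoint card_image)
  finally show ?thesis using B(3) by simp
qed

text \<open>A zero of a nonnegative quadratic form is a minimum, so the gradient there, twice
  \<open>R u\<close>, vanishes. This is what makes a maximizer of the Rayleigh quotient an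
  eigenvector.\<close>

lemma selfadjoint_nonneg_eq_zero:
  fixes R :: "'a::real_inner \<Rightarrow> 'a"
  assumes "linear R" and sym: "\<And>x y. inner (R x) y = inner x (R y)"
    and nonneg: "\<And>x. 0 \<le> inner (R x) x" and isotropic: "inner (R u) u = 0"
  shows "R u = 0"
proof (rule ccontr)
  interpret linear R by fact
  define r s where "r = inner (R u) (R u)" and "s = inner (R (R u)) (R u)"
  \<comment> \<open>Along \<open>u - t *\<^sub>R R u\<close> the form equals
    \<open>t * (t * s - 2 * r)\<close>, negative for small positive \<open>t\<close>. The
    \<open>+ 1\<close> keeps the denominator positive when \<open>s = 0\<close>.\<close>
  define t where "t = r / (s + 1)"
  assume "R u \<noteq> 0"
  then have pos: "r > 0" "s \<ge> 0" unfolding r_def s_def using nonneg by auto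
  have "0 \<le> inner (R (u - t *\<^sub>R R u)) (u - t *\<^sub>R R u)" by (rule nonneg)
  also have "\<dots> = t * (t * s - 2 * r)"
    using isotropic sym[of "R u" u]
    by (simp add: diff scale inner_diff_left inner_diff_right r_def s_def algebra_simps)
  also have "\<dots> < 0"
  proof (rule mult_pos_neg)
    show "t > 0" using pos by (simp add: t_def)
    have "t * s \<le> r" using pos by (simp add: t_def field_simps)
    then show "t * s - 2 * r < 0" using pos by simp
  qed
  finally show False by simp
qed

section \<open>Toeplitz operators and Schur orthogonality\<close>

lemma borel_measurable_cnj [measurable (raw)]:
  "f \<in> borel_measurable M \<Longrightarrow> (\<lambda>x. cnj (f x)) \<in> borel_measurable M"
  by (rule borel_measurable_continuous_on) (intro continuous_intros)

text \<open>Irreducibility is not part of the locale; it enters as a hypothesis from the scalarity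
  of the frame operator on.\<close>

locale unitary_orbit =
  fixes G :: "('g::{t2_space, second_countable_topology}, 'e::euclidean_space) lie_group"
    and \<mu> :: "'g measure" and \<sigma> :: "'g \<Rightarrow> 'h \<Rightarrow> 'h::complex_euclidean_space" and v :: 'h
  assumes Lie_group: "Lie_group G"
    and haar: "normalized_haar_measure G \<mu>"
    and unitary: "unitary_representation G \<sigma>"
    and norm_state: "norm v = 1"
begin

sublocale group G using Lie_group by (simp add: Lie_group_def)

lemma carrier_UNIV [simp]: "carrier G = UNIV"
  using Lie_group by (simp add: Lie_group_def)

sublocale prob_space \<mu> using haar by (simp add: normalized_haar_measure_def)

lemma sets_haar [measurable_cong]: "sets \<mu> = sets borel"
  using haar by (simp add: normalized_haar_measure_def)

lemma space_haar [simp]: "space \<mu> = UNIV"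
  using sets_eq_imp_space_eq[OF sets_haar] by simp

lemma measurable_left_translation [measurable]: "(\<lambda>y. g \<otimes>\<^bsub>G\<^esub> y) \<in> \<mu> \<rightarrow>\<^sub>M \<mu>"
proof -
  have "continuous_on UNIV (\<lambda>(x, y). x \<otimes>\<^bsub>G\<^esub> y)"
    using Lie_group by (simp add: Lie_group_def)
  then have "continuous_on UNIV (\<lambda>y. (\<lambda>(x, y). x \<otimes>\<^bsub>G\<^esub> y) (g, y))"
    by (rule continuous_on_compose2) (auto intro!: continuous_intros)
  then have "(\<lambda>y. g \<otimes>\<^bsub>G\<^esub> y) \<in> borel \<rightarrow>\<^sub>M borel"
    by (simp add: borel_measurable_continuous_onI)
  then show ?thesis by (simp cong: measurable_cong_sets add: sets_haar)
qed

lemma integral_left_translation: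
  fixes F :: "'g \<Rightarrow> complex"
  assumes [measurable]: "F \<in> borel_measurable \<mu>"
  shows "(\<integral>y. F (g \<otimes>\<^bsub>G\<^esub> y) \<partial>\<mu>) = (\<integral>y. F y \<partial>\<mu>)"
proof -
  have "(\<integral>y. F y \<partial>\<mu>) = (\<integral>y. F y \<partial>distr \<mu> \<mu> (\<lambda>x. g \<otimes>\<^bsub>G\<^esub> x))"
    using haar by (simp add: normalized_haar_measure_def)
  also have "\<dots> = (\<integral>y. F (g \<otimes>\<^bsub>G\<^esub> y) \<partial>\<mu>)" by (rule integral_distr) measurable
  finally show ?thesis by simp
qed

section \<open>The unitary action and the orbit of \<open>v\<close>\<close>

lemma
  shows linear_rep: "Vector_Spaces.linear scaleC scaleC (\<sigma> g)"
    and rep_one: "\<sigma> \<one>\<^bsub>G\<^esub> = id"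
    and rep_mult: "\<sigma> (g \<otimes>\<^bsub>G\<^esub> h) u = \<sigma> g (\<sigma> h u)"
    and cinner_rep: "cinner (\<sigma> g u) (\<sigma> g w) = cinner u w"
    and continuous_rep: "continuous_on UNIV (\<lambda>g. \<sigma> g u)"
  using unitary by (auto simp: unitary_representation_def)

lemma rep_scaleC: "\<sigma> g (a *\<^sub>C u) = a *\<^sub>C \<sigma> g u"
proof -
  interpret Vector_Spaces.linear scaleC scaleC "\<sigma> g" by (rule linear_rep)
  show ?thesis by (rule scale)
qed

lemma rep_inv_cancel: "\<sigma> g (\<sigma> (inv\<^bsub>G\<^esub> g) u) = u"
  using rep_mult[of g "inv\<^bsub>G\<^esub> g" u] by (simp add: rep_one r_inv)

lemma cinner_rep_inv: "cinner u (\<sigma> (inv\<^bsub>G\<^esub> g) w) = cinner (\<sigma> g u) w"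
  by (metis cinner_rep rep_inv_cancel)

lemma norm_rep: "norm (\<sigma> g u) = norm u"
  by (simp add: norm_eq_sqrt_inner cinner_rep flip: Re_cinner)

lemma norm_orbit [simp]: "norm (\<sigma> y v) = 1"
  by (simp add: norm_rep norm_state)

lemma measurable_orbit [measurable]: "(\<lambda>y. \<sigma> y v) \<in> borel_measurable \<mu>"
  using borel_measurable_continuous_onI[OF continuous_rep]
  by (simp cong: measurable_cong_sets add: sets_haar)

text \<open>The Toeplitz operator without its dimension factor, written as a vector-valued integral;
  this supplies a witness for \<open>toeplitz\<close>, which is described only through its
  sesquilinear form. For \<open>f = 1\<close> it averages the orthogonal projections onto the lines
  through the orbit of \<open>v\<close>.\<close>

definition frame_operator :: "('g \<Rightarrow> complex) \<Rightarrow> 'h \<Rightarrow> 'h" where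
  "frame_operator f u = (\<integral>y. (f y * cinner u (\<sigma> y v)) *\<^sub>C \<sigma> y v \<partial>\<mu>)"

lemma cinner_frame_operator:
  assumes f: "integrable \<mu> f"
  shows "cinner (frame_operator f u) w =
    (\<integral>y. f y * cinner u (\<sigma> y v) * cnj (cinner w (\<sigma> y v)) \<partial>\<mu>)"
proof -
  have [measurable]: "f \<in> borel_measurable \<mu>" using f by auto
  have "integrable \<mu> (\<lambda>y. f y * cinner u (\<sigma> y v))"
    using cmod_cinner_le[of u "\<sigma> _ v"] by (intro integrable_mult_bounded[OF f, of _ "norm u"]) auto
  then have "integrable \<mu> (\<lambda>y. (f y * cinner u (\<sigma> y v)) *\<^sub>C \<sigma> y v)"
    by (rule Bochner_Integration.integrable_bound) (auto simp: norm_scaleC)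
  then have "cinner (frame_operator f u) w =
      (\<integral>y. cinner ((f y * cinner u (\<sigma> y v)) *\<^sub>C \<sigma> y v) w \<partial>\<mu>)"
    unfolding frame_operator_def
    by (rule integral_bounded_linear[OF bounded_bilinear.bounded_linear_left[OF bounded_bilinear_cinner], symmetric])
  then show ?thesis by (simp add: cinner_scaleC_left flip: cinner_commute)
qed

lemma frame_operator_add:
  assumes "integrable \<mu> f"
  shows "frame_operator f (u + u') = frame_operator f u + frame_operator f u'"
proof (rule cinner_eqI)
  fix w
  have [measurable]: "f \<in> borel_measurable \<mu>" using assms by auto
  have "integrable \<mu> (\<lambda>y. f y * (cinner u (\<sigma> y v) * cnj (cinner w (\<sigma> y v))))" for u
    using cmod_cinner_le[of u "\<sigma> _ v"] cmod_cinner_le[of w "\<sigma> _ v"]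
    by (intro integrable_mult_bounded[OF assms, of _ "norm u * norm w"])
      (auto simp: norm_mult intro!: mult_mono)
  then show "cinner (frame_operator f (u + u')) w = cinner (frame_operator f u + frame_operator f u') w"
    using assms by (simp add: cinner_add_left cinner_frame_operator algebra_simps)
qed

lemma frame_operator_scaleC:
  assumes "integrable \<mu> f"
  shows "frame_operator f (a *\<^sub>C u) = a *\<^sub>C frame_operator f u"
proof (rule cinner_eqI)
  fix w
  show "cinner (frame_operator f (a *\<^sub>C u)) w = cinner (a *\<^sub>C frame_operator f u) w"
    using assms by (simp add: cinner_scaleC_left cinner_frame_operator mult.left_commute mult.assoc)
qed

text \<open>The frame operator gives existence for the definite description, nondegeneracy of
  \<open>cinner\<close> gives uniqueness.\<close>

lemma toeplitz_eq_frame_operator: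
  assumes "integrable \<mu> f"
  shows "toeplitz \<mu> \<sigma> v f = (\<lambda>u. of_nat (cdim TYPE('h)) *\<^sub>C frame_operator f u)"
  unfolding toeplitz_def
proof (rule the_equality)
  let ?A = "\<lambda>u. of_nat (cdim TYPE('h)) *\<^sub>C frame_operator f u"
  have "Vector_Spaces.linear scaleC scaleC ?A"
    using assms
    by unfold_locales (simp_all add: frame_operator_add frame_operator_scaleC
        scaleC_add_right scaleC_scaleC mult.commute)
  then show A: "Vector_Spaces.linear scaleC scaleC ?A \<and> (\<forall>u w. cinner (?A u) w =
      of_nat (cdim TYPE('h)) * (\<integral>y. f y * cinner u (\<sigma> y v) * cnj (cinner w (\<sigma> y v)) \<partial>\<mu>))"
    using assms by (simp add: cinner_scaleC_left cinner_frame_operator)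
  fix A
  assume "Vector_Spaces.linear scaleC scaleC A \<and> (\<forall>u w. cinner (A u) w =
      of_nat (cdim TYPE('h)) * (\<integral>y. f y * cinner u (\<sigma> y v) * cnj (cinner w (\<sigma> y v)) \<partial>\<mu>))"
  with A have "cinner (A u) w = cinner (?A u) w" for u w by (simp only:)
  then show "A = ?A" by (rule ext[OF cinner_eqI])
qed

section \<open>The integral kernel of the Berezin transform\<close>

definition kernel :: "'g \<Rightarrow> 'g \<Rightarrow> real" where
  "kernel x y = cdim TYPE('h) * (cmod (cinner (\<sigma> x v) (\<sigma> y v)))\<^sup>2"

text \<open>Both vectors in the Toeplitz form are \<open>\<sigma> x v\<close>, so its two
  coefficients are conjugate and multiply to a squared modulus.\<close>

lemma berezin_eq_kernel_integral:
  assumes "integrable \<mu> f"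
  shows "berezin \<mu> \<sigma> v f x = (\<integral>y. f y * of_real (kernel x y) \<partial>\<mu>)"
proof -
  have "berezin \<mu> \<sigma> v f x = of_nat (cdim TYPE('h)) *
      (\<integral>y. f y * of_real ((cmod (cinner (\<sigma> x v) (\<sigma> y v)))\<^sup>2) \<partial>\<mu>)"
    using assms
    by (simp add: berezin_def toeplitz_eq_frame_operator cinner_scaleC_left cinner_frame_operator
        mult.assoc flip: complex_norm_square)
  also have "\<dots> = (\<integral>y. of_nat (cdim TYPE('h)) * (f y * of_real ((cmod (cinner (\<sigma> x v) (\<sigma> y v)))\<^sup>2)) \<partial>\<mu>)"
    by (rule integral_mult_right_zero[symmetric])
  finally show ?thesis by (simp add: kernel_def mult.left_commute)
qed

text \<open>Unitarity moves the inverse of \<open>y\<close> to the other side of the inner product: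
  the matrix coefficient at \<open>inv y \<otimes> x\<close> is
  \<open>cinner (\<sigma> y v) (\<sigma> x v)\<close>, whose modulus is symmetric in
  \<open>x\<close> and \<open>y\<close>.\<close>

lemma kernel_integral_eq_convolution:
  "(\<integral>y. f y * of_real (kernel x y) \<partial>\<mu>) = of_nat (cdim TYPE('h)) *
    group_convolution G \<mu> f (\<lambda>g. of_real ((cmod (matrix_coeff \<sigma> v g))\<^sup>2)) x"
proof -
  have "cmod (matrix_coeff \<sigma> v (inv\<^bsub>G\<^esub> y \<otimes>\<^bsub>G\<^esub> x)) = cmod (cinner (\<sigma> x v) (\<sigma> y v))" for y
    unfolding matrix_coeff_def rep_mult cinner_rep_inv
    by (subst cinner_commute) (rule complex_mod_cnj)
  then show ?thesis
    unfolding group_convolution_def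
    by (simp add: kernel_def mult.left_commute flip: integral_mult_right_zero)
qed

text \<open>A linear operator in finite dimension is continuous, and so is the orbit map. This makes
  the transform Borel measurable for every integrable \<open>f\<close>.\<close>

lemma continuous_berezin:
  assumes "integrable \<mu> f"
  shows "continuous_on UNIV (berezin \<mu> \<sigma> v f)"
proof -
  let ?A = "toeplitz \<mu> \<sigma> v f"
  have "linear ?A"
  proof
    show "?A (r *\<^sub>R u) = r *\<^sub>R ?A u" for r u
      using assms
      by (simp add: toeplitz_eq_frame_operator frame_operator_scaleC scaleC_scaleC mult.commute
          flip: scaleC_of_real)
  qed (use assms in \<open>simp add: toeplitz_eq_frame_operator frame_operator_add scaleC_add_right\<close>)
  then have "continuous_on UNIV ?A" by (rule linear_continuous_on_compose[OF continuous_on_id, simplified])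
  then have "continuous_on UNIV (\<lambda>x. ?A (\<sigma> x v))"
    by (rule continuous_on_compose2) (auto intro: continuous_rep)
  then show ?thesis unfolding berezin_def by (intro continuous_intros continuous_rep)
qed

text \<open>An element of the stabilizer multiplies \<open>v\<close> by a phase, which the modulus
  in the kernel forgets.\<close>

lemma berezin_mult_stabilizer:
  assumes "integrable \<mu> f" "l \<in> weight_stabilizer \<sigma> v"
  shows "berezin \<mu> \<sigma> v f (x \<otimes>\<^bsub>G\<^esub> l) = berezin \<mu> \<sigma> v f x"
proof -
  obtain c where c: "\<sigma> l v = c *\<^sub>C v" using assms by (auto simp: weight_stabilizer_def)
  have "cmod c = 1" using norm_orbit[of l] by (simp add: c norm_scaleC norm_state)
  then have "kernel (x \<otimes>\<^bsub>G\<^esub> l) y = kernel x y" for y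
    by (simp add: kernel_def rep_mult c rep_scaleC cinner_scaleC_left norm_mult)
  then show ?thesis using assms by (simp add: berezin_eq_kernel_integral)
qed

text \<open>Left translation by \<open>g\<close> preserves Haar measure; by unitarity it removes
  \<open>\<sigma> g\<close> from the first vector and puts its inverse on the second.\<close>

lemma frame_operator_rep:
  "frame_operator (\<lambda>_. 1) (\<sigma> g u) = \<sigma> g (frame_operator (\<lambda>_. 1) u)"
proof (rule cinner_eqI)
  fix w
  let ?F = "\<lambda>u w y. cinner u (\<sigma> y v) * cnj (cinner w (\<sigma> y v))"
  have "cinner (frame_operator (\<lambda>_. 1) (\<sigma> g u)) w = (\<integral>y. ?F (\<sigma> g u) w y \<partial>\<mu>)"
    by (simp add: cinner_frame_operator)
  also have "\<dots> = (\<integral>y. ?F (\<sigma> g u) w (g \<otimes>\<^bsub>G\<^esub> y) \<partial>\<mu>)"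
    by (rule integral_left_translation[symmetric]) measurable
  also have "\<dots> = (\<integral>y. ?F u (\<sigma> (inv\<^bsub>G\<^esub> g) w) y \<partial>\<mu>)"
  proof (rule Bochner_Integration.integral_cong[OF refl])
    fix y
    have "cinner w (\<sigma> g (\<sigma> y v)) = cinner (\<sigma> (inv\<^bsub>G\<^esub> g) w) (\<sigma> y v)"
      by (metis cinner_rep rep_inv_cancel)
    then show "?F (\<sigma> g u) w (g \<otimes>\<^bsub>G\<^esub> y) = ?F u (\<sigma> (inv\<^bsub>G\<^esub> g) w) y"
      by (simp add: rep_mult cinner_rep)
  qed
  also have "\<dots> = cinner (frame_operator (\<lambda>_. 1) u) (\<sigma> (inv\<^bsub>G\<^esub> g) w)"
    by (simp add: cinner_frame_operator)
  finally show "cinner (frame_operator (\<lambda>_. 1) (\<sigma> g u)) w = cinner (\<sigma> g (frame_operator (\<lambda>_. 1) u)) w"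
    by (simp add: cinner_rep_inv)
qed

section \<open>Scalarity and trace of the frame operator of the constant 1\<close>

lemma linear_frame_operator: "integrable \<mu> f \<Longrightarrow> linear (frame_operator f)"
  by (rule linearI)
    (simp_all add: frame_operator_add frame_operator_scaleC flip: scaleC_of_real)

lemma cinner_frame_operator_self:
  "cinner (frame_operator (\<lambda>_. 1) u) u = of_real (\<integral>y. (cmod (cinner u (\<sigma> y v)))\<^sup>2 \<partial>\<mu>)"
  unfolding cinner_frame_operator[OF integrable_const] mult_1 complex_norm_square[symmetric]
  by (rule integral_complex_of_real)

lemma inner_frame_operator_self:
  "inner (frame_operator (\<lambda>_. 1) u) u = (\<integral>y. (cmod (cinner u (\<sigma> y v)))\<^sup>2 \<partial>\<mu>)"
  by (simp add: cinner_frame_operator_self flip: Re_cinner)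

lemma frame_operator_selfadjoint:
  "inner (frame_operator (\<lambda>_. 1) u) w = inner u (frame_operator (\<lambda>_. 1) w)"
proof -
  have "cinner (frame_operator (\<lambda>_. 1) u) w = cnj (cinner (frame_operator (\<lambda>_. 1) w) u)"
    by (simp add: cinner_frame_operator mult.commute flip: Bochner_Integration.integral_cnj)
  then show ?thesis by (metis Re_cinner cinner_commute)
qed

lemma frame_operator_scalar:
  assumes irr: "irreducible_unitary_representation G \<sigma>"
  obtains m :: real where "\<And>u. frame_operator (\<lambda>_. 1) u = m *\<^sub>R u"
proof -
  let ?S = "frame_operator (\<lambda>_. 1)"
  interpret S: linear ?S by (rule linear_frame_operator) simp
  have cont: "continuous_on (sphere 0 1) (\<lambda>u. inner (?S u) u)"
    by (intro continuous_on_inner linear_continuous_on_compose[OF continuous_on_id] continuous_intros S.linear_axioms)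
  have "v \<in> sphere 0 1" using norm_state by simp
  then obtain u0 where u0: "norm u0 = 1" "\<And>u. norm u = 1 \<Longrightarrow> inner (?S u) u \<le> inner (?S u0) u0"
    using continuous_attains_sup[OF compact_sphere _ cont] by auto
  define m where "m = inner (?S u0) u0"
  \<comment> \<open>The form of \<open>R\<close> is nonnegative because \<open>m\<close> is the
    maximum on the unit sphere, and it vanishes at \<open>u0\<close>; hence \<open>R u0 = 0\<close>,
    so \<open>u0\<close> is an eigenvector.\<close>
  define R where "R u = m *\<^sub>R u - ?S u" for u
  have "R u0 = 0"
  proof (rule selfadjoint_nonneg_eq_zero[of R u0])
    show "linear R" unfolding R_def
      by (intro linear_compose_sub linear_scale_self S.linear_axioms)
    show "inner (R x) y = inner x (R y)" for x y
      by (simp add: R_def inner_diff_left inner_diff_right frame_operator_selfadjoint)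
    show "inner (R u0) u0 = 0"
      using u0(1) by (simp add: R_def inner_diff_left m_def norm_eq_1)
    show "0 \<le> inner (R x) x" for x
    proof (cases "x = 0")
      case False
      define e where "e = x /\<^sub>R norm x"
      have x: "x = norm x *\<^sub>R e" and e: "norm e = 1" using False by (simp_all add: e_def)
      have "inner (R x) x = (norm x)\<^sup>2 * (m - inner (?S e) e)"
        using e by (subst (1 2) x)
          (simp add: R_def S.scale inner_diff_left norm_eq_1 power2_eq_square algebra_simps)
      then show ?thesis using u0(2)[OF e] by (simp add: m_def)
    qed (simp add: R_def)
  qed
  then have u0m: "?S u0 = m *\<^sub>R u0" by (simp add: R_def)
  \<comment> \<open>\<open>?S\<close> is complex linear and commutes with \<open>\<sigma>\<close>,
    so this eigenspace is an invariant complex subspace.\<close>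
  let ?W = "{u. ?S u = m *\<^sub>R u}"
  have "complex_vector.subspace ?W"
    by (rule complex_vector.subspaceI)
      (auto simp: S.zero S.add scaleR_add_right frame_operator_scaleC scaleC_scaleR)
  moreover have "\<sigma> g ` ?W \<subseteq> ?W" for g
    by (auto simp: frame_operator_rep rep_scaleC simp flip: scaleC_of_real)
  ultimately have "?W = {0} \<or> ?W = UNIV"
    using irr unfolding irreducible_unitary_representation_def by blast
  moreover have "u0 \<in> ?W" "u0 \<noteq> 0" using u0m u0(1) by auto
  ultimately have "?W = UNIV" by blast
  then show thesis by (intro that[of m]) auto
qed

lemma schur_orthogonality:
  assumes "irreducible_unitary_representation G \<sigma>"
  shows "cdim TYPE('h) * (\<integral>y. (cmod (cinner u (\<sigma> y v)))\<^sup>2 \<partial>\<mu>) = (norm u)\<^sup>2"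
proof -
  let ?S = "frame_operator (\<lambda>_. 1)"
  obtain m where m: "\<And>u. ?S u = m *\<^sub>R u" using frame_operator_scalar[OF assms] by blast
  have int: "integrable \<mu> (\<lambda>y. (cmod (cinner u (\<sigma> y v)))\<^sup>2)" for u
    using cmod_cinner_le[of u "\<sigma> _ v"]
    by (intro integrable_const_bound[of _ "(norm u)\<^sup>2"]) (auto intro!: power_mono)
  \<comment> \<open>The trace over the real \<open>Basis\<close> in two ways: orbit vectors have
    norm 1, which gives 2, while the scalar operator gives \<open>DIM('h) * m\<close>, that is,
    twice the complex dimension times \<open>m\<close>.\<close>
  have "2 = (\<integral>y. (\<Sum>b\<in>Basis. (cmod (cinner b (\<sigma> y v)))\<^sup>2) \<partial>\<mu>)"
    by (simp add: sum_Basis_cmod_cinner prob_space[simplified])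
  also have "\<dots> = (\<Sum>b\<in>Basis. inner (?S b) b)"
    by (simp add: int inner_frame_operator_self)
  also have "\<dots> = DIM('h) * m" by (simp add: m)
  finally have "cdim TYPE('h) * m = 1" by (simp add: DIM_eq_cdim)
  moreover have "(\<integral>y. (cmod (cinner u (\<sigma> y v)))\<^sup>2 \<partial>\<mu>) = m * (norm u)\<^sup>2"
    using inner_frame_operator_self[of u] by (simp add: m power2_norm_eq_inner)
  ultimately show ?thesis by (metis mult.assoc mult_1)
qed

text \<open>The marginal integral is Schur orthogonality for the unit vector
  \<open>\<sigma> x v\<close>, and the bound is Cauchy-Schwarz.\<close>

lemma stochastic_kernel:
  assumes "irreducible_unitary_representation G \<sigma>"
  shows "symmetric_stochastic_kernel \<mu> kernel (cdim TYPE('h))"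
proof
  show "case_prod kernel \<in> borel_measurable (\<mu> \<Otimes>\<^sub>M \<mu>)"
    unfolding kernel_def by measurable
  show "kernel x \<in> borel_measurable \<mu>" for x
    unfolding kernel_def by measurable
  show "kernel x y \<le> cdim TYPE('h)" for x y
    using cmod_cinner_le[of "\<sigma> x v" "\<sigma> y v"]
    by (simp add: kernel_def mult_left_le power_le_one)
  show "kernel x y = kernel y x" for x y
    unfolding kernel_def by (subst cinner_commute) simp
  show "(\<integral>y. kernel x y \<partial>\<mu>) = 1" for x
    using schur_orthogonality[OF assms, of "\<sigma> x v"] by (simp add: kernel_def)
qed (simp add: kernel_def)

end

section \<open>The Berezin transform as a convolution and as a contraction\<close>

theorem proposition6p2:
  fixes G :: "('g::{t2_space, second_countable_topology}, 'e::euclidean_space) lie_group"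
    and T :: "'g set"
    and P :: "('e \<Rightarrow> complex) set"
    and \<mu> :: "'g measure"
    and lam :: "'e \<Rightarrow> complex"
    and \<sigma> :: "'g \<Rightarrow> 'h \<Rightarrow> 'h::complex_euclidean_space"
    and v :: 'h
    and p :: ennreal
    and L :: "'g set"
  assumes "compact_connected_Lie_group G"
    and "normalized_haar_measure G \<mu>"
    and "maximal_torus G T"
    and "positive_system G T P"
    and "analytically_integral G T lam"
    and "dominant G T P lam"
    and "irreducible_unitary_representation G \<sigma>"
    and "highest_weight_vector G T P \<sigma> lam v"
    and "norm v = 1"
    and "L = weight_stabilizer \<sigma> v"
    and "1 \<le> p"
  shows "(\<forall>f\<in>Lp_quotient G \<mu> L p. \<forall>x.
            berezin \<mu> \<sigma> v f x =
              of_nat (cdim TYPE('h)) *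
                group_convolution G \<mu> f (\<lambda>g. of_real ((cmod (matrix_coeff \<sigma> v g))\<^sup>2)) x) \<and>
         Lp_quotient_operator G \<mu> L p (berezin \<mu> \<sigma> v) \<and>
         op_norm \<mu> p (Lp_quotient G \<mu> L p) (berezin \<mu> \<sigma> v) \<le> 1"
proof -
  interpret unitary_orbit G \<mu> \<sigma> v
    using assms(1,2,7,9)
    by (intro unitary_orbit.intro)
      (simp_all only: compact_connected_Lie_group_def irreducible_unitary_representation_def)
  interpret K: symmetric_stochastic_kernel \<mu> kernel "cdim TYPE('h)"
    using assms(7) by (rule stochastic_kernel)
  let ?V = "Lp_quotient G \<mu> L p" and ?B = "berezin \<mu> \<sigma> v"
  \<comment> \<open>Every \<open>f\<close> in \<open>?V\<close> is integrable because Haar measure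
    is a probability measure, so the kernel formula is available for all \<open>p\<close>.\<close>
  have int: "integrable \<mu> f" if "f \<in> ?V" for f
    using that unfolding Lp_quotient_def by (blast intro: integrable_Lp[OF \<open>1 \<le> p\<close>])
  have B: "?B f = (\<lambda>x. \<integral>y. f y * of_real (kernel x y) \<partial>\<mu>)" if "f \<in> ?V" for f
    using berezin_eq_kernel_integral[OF int[OF that]] by (rule ext)
  have meas: "?B f \<in> borel_measurable \<mu>" if "f \<in> ?V" for f
    using borel_measurable_continuous_onI[OF continuous_berezin[OF int[OF that]]]
    by (simp cong: measurable_cong_sets add: sets_haar)
  have le: "Lp_norm \<mu> p (?B f) \<le> Lp_norm \<mu> p f" if "f \<in> ?V" for f
    using K.Lp_norm_kernel_integral_le[OF \<open>1 \<le> p\<close>, of f] meas[OF that] that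
    by (simp add: B Lp_quotient_def)
  have "?B f \<in> ?V" if "f \<in> ?V" for f
    using meas[OF that] le_less_trans[OF le[OF that]] that
      berezin_mult_stabilizer[OF int[OF that]] \<open>L = weight_stabilizer \<sigma> v\<close>
    by (simp add: Lp_quotient_def)
  \<comment> \<open>Linearity and compatibility with null sets hold at every \<open>x\<close>, not
    just almost everywhere, because \<open>?B f x\<close> is an integral in
    \<open>y\<close>.\<close>
  moreover have "?B (\<lambda>y. a * f y + b * h y) x = a * ?B f x + b * ?B h x"
    if "f \<in> ?V" "h \<in> ?V" for f h a b x
  proof -
    have f: "integrable \<mu> (\<lambda>y. a * f y)" and h: "integrable \<mu> (\<lambda>y. b * h y)"
      using that int by auto
    have "?B (\<lambda>y. a * f y + b * h y) x =
        (\<integral>y. a * f y * of_real (kernel x y) + b * h y * of_real (kernel x y) \<partial>\<mu>)"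
      using f h by (simp add: berezin_eq_kernel_integral distrib_right)
    also have "\<dots> = (\<integral>y. a * f y * of_real (kernel x y) \<partial>\<mu>) + (\<integral>y. b * h y * of_real (kernel x y) \<partial>\<mu>)"
      by (intro Bochner_Integration.integral_add K.kernel_integrable f h)
    finally show ?thesis using that by (simp add: B mult.assoc)
  qed
  moreover have "?B f x = ?B h x"
    if "f \<in> ?V" "h \<in> ?V" "AE y in \<mu>. f y = h y" for f h x
  proof -
    have "(\<integral>y. f y * of_real (kernel x y) \<partial>\<mu>) = (\<integral>y. h y * of_real (kernel x y) \<partial>\<mu>)"
      using that(3) K.kernel_integrable[OF int[OF that(1)]] K.kernel_integrable[OF int[OF that(2)]]
      by (intro integral_cong_AE) auto
    then show ?thesis using that by (simp add: B)
  qed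
  ultimately have "Lp_quotient_operator G \<mu> L p ?B"
    unfolding Lp_quotient_operator_def by blast
  moreover have "op_norm \<mu> p ?V ?B \<le> 1"
    unfolding op_norm_def by (rule SUP_least) (auto intro: order_trans[OF le])
  ultimately show ?thesis by (simp add: B kernel_integral_eq_convolution)
qed

end
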